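(* Let $D$ be a PVMD. Then $D$ is a generalized Krull domain if and only if $D$ is completely integrally closed and every maximal $t$-ideal of $D$ is potent.
   Context: $D$ is an integral domain with quotient field $K$. For a nonzero fractional ideal $I$ put $I^{-1}=\{x\in K\mid xI\subseteq D\}$, $I_v=(I^{-1})^{-1}$, and $I_t=\bigcup\{J_v\mid J\subseteq I,\ J \text{ a nonzero finitely generated fractional ideal}\}$. $I$ is a $t$-ideal if $I_t=I$; a maximal $t$-ideal is an ideal maximal among the $t$-ideals properly contained in $D$ (it is a prime ideal). $D$ is a PVMD (Prüfer $v$-multiplication domain) if $(II^{-1})_t=D$ for every nonzero finitely generated ideal $I$ of $D$. A maximal $t$-ideal $P$ is potent if it contains a nonzero finitely generated ideal that is not contained in any other maximal $t$-ideal. $D$ is a generalized Krull domain if it is a locally finite intersection of essential rank-one valuation domains, i.e. $D=\bigcap_{P\in F}D_P$ for a family $F$ of prime ideals such that each $D_P$ is a rank-one valuation domain and each nonzero nonunit of $D$ lies in only finitely many $P\in F$ (the empty intersection is $K$). $D$ is completely integrally closed if whenever $x\in K$ and $0\ne r\in D$ satisfy $rx^n\in D$ for every integer $n\ge1$, then $x\in D$. *)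

theory Defs
  imports Complex_Main "HOL-Computational_Algebra.Fraction_Field"
begin

text \<open>
  The quotient field \<open>K\<close> is the whole type \<open>'k\<close>; an integral domain with quotient field \<open>K\<close> is a
  subring \<open>D\<close> of \<open>K\<close> such that every element of \<open>K\<close> is a quotient of elements of \<open>D\<close>.
  By \<open>domain_with_quotient_field_range_Fract\<close> below, every integral domain arises in this way.
\<close>

definition domain_with_quotient_field :: "'k::field set \<Rightarrow> bool" where
  "domain_with_quotient_field D \<longleftrightarrow>
     1 \<in> D \<and> (\<forall>x\<in>D. \<forall>y\<in>D. x - y \<in> D \<and> x * y \<in> D) \<and>
     (\<forall>x. \<exists>a\<in>D. \<exists>b\<in>D. b \<noteq> 0 \<and> x = a / b)"

lemma domain_with_quotient_field_range_Fract:
  "domain_with_quotient_field (range (\<lambda>a::'a::idom. Fract a 1))"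
  unfolding domain_with_quotient_field_def
proof (intro conjI ballI allI)
  show "1 \<in> range (\<lambda>a::'a. Fract a 1)"
    by (auto simp: One_fract_def)
next
  fix x y :: "'a fract"
  assume "x \<in> range (\<lambda>a. Fract a 1)" "y \<in> range (\<lambda>a. Fract a 1)"
  then obtain a b where "x = Fract a 1" "y = Fract b 1"
    by auto
  then have "x - y = Fract (a - b) 1" "x * y = Fract (a * b) 1"
    by simp_all
  then show "x - y \<in> range (\<lambda>a. Fract a 1)" "x * y \<in> range (\<lambda>a. Fract a 1)"
    by blast+
next
  fix x :: "'a fract"
  obtain a b where ab: "x = Fract a b" "b \<noteq> 0"
    by (cases x) auto
  then have "Fract b 1 \<noteq> 0" "x = Fract a 1 / Fract b 1"
    by (simp_all add: Zero_fract_def eq_fract)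
  then show "\<exists>u\<in>range (\<lambda>a. Fract a 1). \<exists>v\<in>range (\<lambda>a. Fract a 1). v \<noteq> 0 \<and> x = u / v"
    by blast
qed


definition submodule :: "'k::field set \<Rightarrow> 'k set \<Rightarrow> bool" where
  "submodule D M \<longleftrightarrow>
     0 \<in> M \<and> (\<forall>x\<in>M. \<forall>y\<in>M. x + y \<in> M) \<and> (\<forall>r\<in>D. \<forall>x\<in>M. r * x \<in> M)"

definition fractional_ideal :: "'k::field set \<Rightarrow> 'k set \<Rightarrow> bool" where
  "fractional_ideal D I \<longleftrightarrow> submodule D I \<and> (\<exists>d\<in>D. d \<noteq> 0 \<and> (\<forall>x\<in>I. d * x \<in> D))"

definition ideal :: "'k::field set \<Rightarrow> 'k set \<Rightarrow> bool" where
  "ideal D I \<longleftrightarrow> submodule D I \<and> I \<subseteq> D"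

definition prime_ideal :: "'k::field set \<Rightarrow> 'k set \<Rightarrow> bool" where
  "prime_ideal D P \<longleftrightarrow>
     ideal D P \<and> P \<noteq> D \<and> (\<forall>x\<in>D. \<forall>y\<in>D. x * y \<in> P \<longrightarrow> x \<in> P \<or> y \<in> P)"

definition finitely_generated :: "'k::field set \<Rightarrow> 'k set \<Rightarrow> bool" where
  "finitely_generated D I \<longleftrightarrow> (\<exists>S. finite S \<and> I = submodule D hull S)"

definition ideal_product :: "'k::field set \<Rightarrow> 'k set \<Rightarrow> 'k set \<Rightarrow> 'k set" where
  "ideal_product D I J = (submodule D) hull {x * y | x y. x \<in> I \<and> y \<in> J}"


definition ideal_inverse :: "'k::field set \<Rightarrow> 'k set \<Rightarrow> 'k set" where
  "ideal_inverse D I = {x. \<forall>y\<in>I. x * y \<in> D}"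

definition v_closure :: "'k::field set \<Rightarrow> 'k set \<Rightarrow> 'k set" where
  "v_closure D I = ideal_inverse D (ideal_inverse D I)"

definition t_closure :: "'k::field set \<Rightarrow> 'k set \<Rightarrow> 'k set" where
  "t_closure D I =
     \<Union>{v_closure D J | J. J \<subseteq> I \<and> J \<noteq> {0} \<and> fractional_ideal D J \<and> finitely_generated D J}"

definition t_ideal :: "'k::field set \<Rightarrow> 'k set \<Rightarrow> bool" where
  "t_ideal D I \<longleftrightarrow> fractional_ideal D I \<and> I \<noteq> {0} \<and> t_closure D I = I"

definition maximal_t_ideal :: "'k::field set \<Rightarrow> 'k set \<Rightarrow> bool" where
  "maximal_t_ideal D P \<longleftrightarrow>
     t_ideal D P \<and> P \<subset> D \<and> (\<forall>Q. t_ideal D Q \<and> Q \<subset> D \<and> P \<subseteq> Q \<longrightarrow> Q = P)"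

definition PVMD :: "'k::field set \<Rightarrow> bool" where
  "PVMD D \<longleftrightarrow>
     (\<forall>I. ideal D I \<and> I \<noteq> {0} \<and> finitely_generated D I \<longrightarrow>
        t_closure D (ideal_product D I (ideal_inverse D I)) = D)"

definition potent :: "'k::field set \<Rightarrow> 'k set \<Rightarrow> bool" where
  "potent D P \<longleftrightarrow>
     (\<exists>I. ideal D I \<and> I \<noteq> {0} \<and> finitely_generated D I \<and> I \<subseteq> P \<and>
        (\<forall>Q. maximal_t_ideal D Q \<and> I \<subseteq> Q \<longrightarrow> Q = P))"


definition localization :: "'k::field set \<Rightarrow> 'k set \<Rightarrow> 'k set" where
  "localization D P = {x / s | x s. x \<in> D \<and> s \<in> D \<and> s \<notin> P}"

definition valuation_domain :: "'k::field set \<Rightarrow> bool" where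
  "valuation_domain V \<longleftrightarrow>
     domain_with_quotient_field V \<and> (\<forall>x. x \<noteq> 0 \<longrightarrow> x \<in> V \<or> inverse x \<in> V)"

text \<open>The rank of a valuation domain is the number of its nonzero prime ideals.\<close>

definition rank_one_valuation_domain :: "'k::field set \<Rightarrow> bool" where
  "rank_one_valuation_domain V \<longleftrightarrow>
     valuation_domain V \<and> (\<exists>!P. prime_ideal V P \<and> P \<noteq> {0})"

text \<open>For \<open>F = {}\<close> the intersection is \<open>UNIV\<close>, i.e. the quotient field; a nonzero \<open>x \<in> D\<close> is a
  nonunit iff its inverse in the quotient field is not in \<open>D\<close>.\<close>

definition generalized_krull_domain :: "'k::field set \<Rightarrow> bool" where
  "generalized_krull_domain D \<longleftrightarrow>
     (\<exists>F. (\<forall>P\<in>F. prime_ideal D P \<and> rank_one_valuation_domain (localization D P)) \<and>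
          D = (\<Inter>P\<in>F. localization D P) \<and>
          (\<forall>x\<in>D. x \<noteq> 0 \<and> inverse x \<notin> D \<longrightarrow> finite {P \<in> F. x \<in> P}))"

definition completely_integrally_closed :: "'k::field set \<Rightarrow> bool" where
  "completely_integrally_closed D \<longleftrightarrow>
     (\<forall>x. (\<exists>r\<in>D. r \<noteq> 0 \<and> (\<forall>n\<ge>1. r * x ^ n \<in> D)) \<longrightarrow> x \<in> D)"

end

theory Submission
  imports Defs
begin

text \<open>
  Over a PVMD the localizations at the maximal \<open>t\<close>-ideals are valuation domains with
  intersection \<open>D\<close>. Let \<open>P\<close> be the only maximal \<open>t\<close>-ideal containing a finite set \<open>S\<close>, and
  suppose that some \<open>r \<noteq> 0\<close> is divisible in \<open>D\<^sub>P\<close> by all powers of some \<open>a \<in> P\<close>. If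
  \<open>w (S \<union> {a}) \<subseteq> D\<close>, then \<open>r w\<^sup>n = (r / a\<^sup>n) (w a)\<^sup>n\<close> lies in \<open>D\<^sub>P\<close>, and in every other
  localization because \<open>w\<close> does. Complete integral closure gives \<open>w \<in> D\<close>, whence
  \<open>1 \<in> (S \<union> {a})\<^sub>v \<subseteq> P\<close>, a contradiction. So \<open>D\<^sub>P\<close> is archimedean, that is, of rank one.

  For local finiteness at \<open>x \<noteq> 0\<close>, consider the ideal of all \<open>y\<close> such that \<open>y B \<subseteq> x D\<close>
  for some \<open>B\<close> contained in only finitely many maximal \<open>t\<close>-ideals. By potency and the
  archimedean property it lies in no maximal \<open>t\<close>-ideal, so its \<open>t\<close>-closure contains \<open>1\<close>; hence
  one such \<open>B\<close> satisfies \<open>B \<subseteq> x D\<close>, and only finitely many maximal \<open>t\<close>-ideals contain \<open>x\<close>.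

  Conversely, if \<open>D\<close> is a generalized Krull domain with defining family \<open>F\<close>, then the nonzero
  members of \<open>F\<close> are \<open>t\<close>-ideals, and local finiteness puts every maximal \<open>t\<close>-ideal into \<open>F\<close>
  and makes it potent.
\<close>

section \<open>Submodules and finite sets of generators\<close>

lemma submodule_Inter:
  assumes "\<And>M. M \<in> \<M> \<Longrightarrow> submodule D M"
  shows "submodule D (\<Inter>\<M>)"
  using assms unfolding submodule_def by blast

lemma submodule_hull: "submodule D (submodule D hull S)"
  by (metis hull_in submodule_Inter)

lemma submodule_zero: "submodule D M \<Longrightarrow> 0 \<in> M"
  and submodule_add: "submodule D M \<Longrightarrow> x \<in> M \<Longrightarrow> y \<in> M \<Longrightarrow> x + y \<in> M"
  and submodule_scale: "submodule D M \<Longrightarrow> r \<in> D \<Longrightarrow> x \<in> M \<Longrightarrow> r * x \<in> M"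
  by (simp_all add: submodule_def)

lemma hull_subset_zero:
  assumes "S \<subseteq> {0}"
  shows "submodule D hull S = {0}"
proof
  show "submodule D hull S \<subseteq> {0}"
    using assms by (rule hull_minimal) (simp add: submodule_def)
  show "{0} \<subseteq> submodule D hull S"
    using submodule_zero[OF submodule_hull] by simp
qed

section \<open>Inverses and the v-closure as a Galois connection\<close>

lemma ideal_inverse_antimono: "I \<subseteq> J \<Longrightarrow> ideal_inverse D J \<subseteq> ideal_inverse D I"
  by (auto simp: ideal_inverse_def)

lemma v_closure_mono: "I \<subseteq> J \<Longrightarrow> v_closure D I \<subseteq> v_closure D J"
  by (simp add: v_closure_def ideal_inverse_antimono)

lemma v_closure_extensive: "I \<subseteq> v_closure D I"
  by (auto simp: v_closure_def ideal_inverse_def mult.commute)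

text \<open>Three inverses collapse to one, because inversion reverses inclusions and two inversions
  only enlarge a set.\<close>

lemma ideal_inverse_v_closure: "ideal_inverse D (v_closure D I) = ideal_inverse D I"
  using ideal_inverse_antimono[OF v_closure_extensive]
    v_closure_extensive[of "ideal_inverse D I" D]
  by (auto simp: v_closure_def)

lemma v_closure_minimal: "S \<subseteq> v_closure D I \<Longrightarrow> v_closure D S \<subseteq> v_closure D I"
  using ideal_inverse_antimono[of S "v_closure D I" D]
  by (simp add: ideal_inverse_v_closure) (simp add: v_closure_def ideal_inverse_antimono)

text \<open>The working form of \<open>1 \<in> v_closure D S\<close>: to put an element into
  \<open>D\<close>, it suffices that it multiplies \<open>S\<close> into \<open>D\<close>.\<close>

lemma one_in_v_closure_iff: "1 \<in> v_closure D S \<longleftrightarrow> ideal_inverse D S \<subseteq> D"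
  by (auto simp: v_closure_def ideal_inverse_def[of D "ideal_inverse D S"])

lemma t_closure_mono: "I \<subseteq> J \<Longrightarrow> t_closure D I \<subseteq> t_closure D J"
  unfolding t_closure_def by blast

text \<open>A locale, so that the basic facts can be interpreted for valuation overrings and
  localizations of \<open>D\<close> as well as for \<open>D\<close> itself.\<close>

locale quotient_domain =
  fixes D :: "'k::field set"
  assumes domain: "domain_with_quotient_field D"
begin

lemma one_mem: "1 \<in> D"
  and diff_mem: "x \<in> D \<Longrightarrow> y \<in> D \<Longrightarrow> x - y \<in> D"
  and mult_mem: "x \<in> D \<Longrightarrow> y \<in> D \<Longrightarrow> x * y \<in> D"
  using domain by (auto simp: domain_with_quotient_field_def)

lemma zero_mem: "0 \<in> D"
  using diff_mem[OF one_mem one_mem] by simp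

lemma add_mem: "x \<in> D \<Longrightarrow> y \<in> D \<Longrightarrow> x + y \<in> D"
  using diff_mem[of x "0 - y"] diff_mem[OF zero_mem] by simp

lemma power_mem: "x \<in> D \<Longrightarrow> x ^ n \<in> D"
  by (induction n) (auto simp: one_mem mult_mem)

lemma fraction_cases:
  obtains a b where "a \<in> D" "b \<in> D" "b \<noteq> 0" "x = a / b"
  using domain unfolding domain_with_quotient_field_def by blast

lemma submodule_D: "submodule D D"
  by (simp add: submodule_def zero_mem add_mem mult_mem)

lemma submodule_ideal_inverse: "submodule D (ideal_inverse D S)"
  unfolding submodule_def ideal_inverse_def
  by (auto simp: zero_mem add_mem mult_mem distrib_right mult.assoc)

lemma submodule_v_closure: "submodule D (v_closure D S)"
  by (simp add: v_closure_def submodule_ideal_inverse)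

text \<open>The v-closure of \<open>S\<close> is a submodule containing \<open>S\<close>, hence
  contains the hull. Inverses can therefore be computed on generators, and finite sets can stand in
  for finitely generated ideals.\<close>

lemma ideal_inverse_hull: "ideal_inverse D (submodule D hull S) = ideal_inverse D S"
proof
  show "ideal_inverse D (submodule D hull S) \<subseteq> ideal_inverse D S"
    by (intro ideal_inverse_antimono hull_subset)
  show "ideal_inverse D S \<subseteq> ideal_inverse D (submodule D hull S)"
    using ideal_inverse_antimono[OF hull_minimal[of S "v_closure D S" "submodule D"], of D]
    by (simp add: v_closure_extensive submodule_v_closure ideal_inverse_v_closure)
qed

lemma v_closure_hull: "v_closure D (submodule D hull S) = v_closure D S"
  by (simp add: v_closure_def ideal_inverse_hull)

lemma common_denominator:
  assumes "finite S"
  shows "\<exists>d\<in>D. d \<noteq> 0 \<and> d \<in> ideal_inverse D S"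
  using assms
proof (induction S)
  case empty
  then show ?case by (auto intro!: bexI[of _ 1] simp: one_mem ideal_inverse_def)
next
  case (insert x S)
  then obtain d where d: "d \<in> D" "d \<noteq> 0" "d \<in> ideal_inverse D S" by blast
  obtain a b where ab: "a \<in> D" "b \<in> D" "b \<noteq> 0" "x = a / b" by (rule fraction_cases)
  have "d * b * y \<in> D" if "y \<in> insert x S" for y
  proof (cases "y = x")
    case True
    then show ?thesis using ab d by (simp add: mult_mem)
  next
    case False
    then have "d * y \<in> D" using that d by (simp add: ideal_inverse_def)
    then show ?thesis using mult_mem[OF ab(2), of "d * y"] by (simp add: algebra_simps)
  qed
  then show ?case
    using ab d by (intro bexI[of _ "d * b"]) (auto simp: ideal_inverse_def mult_mem)
qed

lemma fractional_ideal_hull: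
  assumes "finite S"
  shows "fractional_ideal D (submodule D hull S)"
proof -
  obtain d where "d \<in> D" "d \<noteq> 0" "d \<in> ideal_inverse D S"
    using common_denominator[OF assms] by blast
  then show ?thesis
    unfolding fractional_ideal_def
    by (metis (no_types, lifting) ideal_inverse_def ideal_inverse_hull mem_Collect_eq submodule_hull)
qed

section \<open>The t-closure through finite sets\<close>

text \<open>This is the finite character of the t-closure, freed of fractional ideals. The condition
  \<open>\<not> S \<subseteq> {0}\<close> says that the generated module is nonzero.\<close>

lemma t_closure_iff:
  assumes "submodule D I"
  shows "x \<in> t_closure D I \<longleftrightarrow>
    (\<exists>S. finite S \<and> S \<subseteq> I \<and> \<not> S \<subseteq> {0} \<and> x \<in> v_closure D S)"
proof
  assume "x \<in> t_closure D I"
  then obtain S where S: "finite S" "submodule D hull S \<subseteq> I" "submodule D hull S \<noteq> {0}"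
    "x \<in> v_closure D (submodule D hull S)"
    unfolding t_closure_def finitely_generated_def by blast
  have "\<not> S \<subseteq> {0}" using S(3) hull_subset_zero by blast
  then show "\<exists>S. finite S \<and> S \<subseteq> I \<and> \<not> S \<subseteq> {0} \<and> x \<in> v_closure D S"
    using S hull_subset[of S "submodule D"] by (metis dual_order.trans v_closure_hull)
next
  assume "\<exists>S. finite S \<and> S \<subseteq> I \<and> \<not> S \<subseteq> {0} \<and> x \<in> v_closure D S"
  then obtain S where S: "finite S" "S \<subseteq> I" "\<not> S \<subseteq> {0}" "x \<in> v_closure D S" by blast
  then have "submodule D hull S \<subseteq> I" "submodule D hull S \<noteq> {0}"
    using assms hull_minimal[of S I] hull_subset[of S "submodule D"] by blast+
  then show "x \<in> t_closure D I"
    unfolding t_closure_def finitely_generated_def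
    using S fractional_ideal_hull[OF S(1)] v_closure_hull by blast
qed

lemma t_closure_extensive:
  assumes "submodule D I" "I \<noteq> {0}"
  shows "I \<subseteq> t_closure D I"
proof
  fix x assume x: "x \<in> I"
  \<comment> \<open>Adjoining a nonzero \<open>a\<close> keeps the finite set \<open>{a, x}\<close>
    admissible even when \<open>x = 0\<close>.\<close>
  obtain a where "a \<in> I" "a \<noteq> 0"
    using assms submodule_zero by blast
  then show "x \<in> t_closure D I"
    using x v_closure_extensive[of "{a, x}" D]
    by (subst t_closure_iff[OF assms(1)]) (auto intro!: exI[of _ "{a, x}"])
qed

lemma v_closure_subset_D:
  assumes "S \<subseteq> D"
  shows "v_closure D S \<subseteq> D"
proof -
  have "1 \<in> ideal_inverse D S" using assms by (auto simp: ideal_inverse_def)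
  then show ?thesis by (force simp: v_closure_def ideal_inverse_def[of _ "ideal_inverse D S"])
qed

lemma fractional_ideal_if_ideal: "ideal D I \<Longrightarrow> fractional_ideal D I"
  unfolding ideal_def fractional_ideal_def
  by (auto intro!: bexI[of _ 1] simp: one_mem)

lemma ideal_t_closure:
  assumes "ideal D I" "I \<noteq> {0}"
  shows "ideal D (t_closure D I)"
proof -
  have I: "submodule D I" "I \<subseteq> D" using assms by (auto simp: ideal_def)
  note iff = t_closure_iff[OF I(1)]
  have "0 \<in> t_closure D I"
    using t_closure_extensive[OF I(1) assms(2)] submodule_zero[OF I(1)] by blast
  moreover have "x + y \<in> t_closure D I" if xy: "x \<in> t_closure D I" "y \<in> t_closure D I" for x y
  proof -
    obtain S T where S: "finite S" "S \<subseteq> I" "\<not> S \<subseteq> {0}" "x \<in> v_closure D S"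
      and T: "finite T" "T \<subseteq> I" "y \<in> v_closure D T"
      using xy unfolding iff by blast
    have "x \<in> v_closure D (S \<union> T)" "y \<in> v_closure D (S \<union> T)"
      using S T v_closure_mono[of S "S \<union> T"] v_closure_mono[of T "S \<union> T"] by blast+
    then have "x + y \<in> v_closure D (S \<union> T)" by (intro submodule_add[OF submodule_v_closure])
    then show ?thesis using S T unfolding iff by (intro exI[of _ "S \<union> T"]) auto
  qed
  moreover have "r * x \<in> t_closure D I" if "r \<in> D" "x \<in> t_closure D I" for r x
    using that submodule_scale[OF submodule_v_closure] unfolding iff by blast
  moreover have "t_closure D I \<subseteq> D"
    using I(2) v_closure_subset_D unfolding iff subset_iff by blast
  ultimately show ?thesis by (simp add: ideal_def submodule_def)
qed

text \<open>Each of the finitely many elements of \<open>S\<close> is caught by a finite subset of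
  \<open>I\<close>. The union of these subsets is finite, and its v-closure contains that of
  \<open>S\<close>.\<close>

lemma t_closure_idem:
  assumes "ideal D I" "I \<noteq> {0}"
  shows "t_closure D (t_closure D I) = t_closure D I"
proof
  have I: "submodule D I" and tI: "submodule D (t_closure D I)"
    using assms(1) ideal_t_closure[OF assms] by (simp_all add: ideal_def)
  have nz: "t_closure D I \<noteq> {0}"
    using t_closure_extensive[OF I assms(2)] assms(2) submodule_zero[OF I] by blast
  show "t_closure D I \<subseteq> t_closure D (t_closure D I)"
    by (rule t_closure_extensive[OF tI nz])
  show "t_closure D (t_closure D I) \<subseteq> t_closure D I"
  proof
    fix x assume "x \<in> t_closure D (t_closure D I)"
    then obtain S where S: "finite S" "S \<subseteq> t_closure D I" "\<not> S \<subseteq> {0}" "x \<in> v_closure D S"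
      unfolding t_closure_iff[OF tI] by blast
    have "\<forall>s\<in>S. \<exists>T. finite T \<and> T \<subseteq> I \<and> \<not> T \<subseteq> {0} \<and> s \<in> v_closure D T"
      using S(2) t_closure_iff[OF I] by blast
    then obtain T where T: "\<And>s. s \<in> S \<Longrightarrow> finite (T s) \<and> T s \<subseteq> I \<and> \<not> T s \<subseteq> {0} \<and> s \<in> v_closure D (T s)"
      by metis
    have "S \<subseteq> v_closure D (\<Union>(T ` S))"
    proof
      fix s assume s: "s \<in> S"
      then have "T s \<subseteq> \<Union>(T ` S)" by blast
      then show "s \<in> v_closure D (\<Union>(T ` S))" using v_closure_mono T[OF s] by blast
    qed
    then have "x \<in> v_closure D (\<Union>(T ` S))" using v_closure_minimal S(4) by blast
    moreover have "finite (\<Union>(T ` S))" "\<Union>(T ` S) \<subseteq> I" using T S(1) by auto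
    moreover have "\<not> \<Union>(T ` S) \<subseteq> {0}" using T S(3) by blast
    ultimately show "x \<in> t_closure D I" unfolding t_closure_iff[OF I] by blast
  qed
qed

section \<open>Maximal \<open>t\<close>-ideals\<close>

lemma maximal_t_ideal_submodule: "maximal_t_ideal D P \<Longrightarrow> submodule D P"
  and maximal_t_ideal_subset: "maximal_t_ideal D P \<Longrightarrow> P \<subseteq> D"
  and maximal_t_ideal_nonzero: "maximal_t_ideal D P \<Longrightarrow> P \<noteq> {0}"
  and maximal_t_ideal_closed: "maximal_t_ideal D P \<Longrightarrow> t_closure D P = P"
  by (auto simp: maximal_t_ideal_def t_ideal_def fractional_ideal_def)

lemma maximal_t_ideal_eqI:
  "maximal_t_ideal D P \<Longrightarrow> maximal_t_ideal D Q \<Longrightarrow> P \<subseteq> Q \<Longrightarrow> Q = P"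
  by (auto simp: maximal_t_ideal_def)

lemma one_notin_proper_submodule: "submodule D P \<Longrightarrow> P \<subset> D \<Longrightarrow> 1 \<notin> P"
  by (metis mult.right_neutral psubset_eq subset_antisym submodule_scale subsetI)

lemma one_notin_maximal_t_ideal: "maximal_t_ideal D P \<Longrightarrow> 1 \<notin> P"
  by (intro one_notin_proper_submodule)
     (auto simp: maximal_t_ideal_def t_ideal_def fractional_ideal_def)

lemma v_closure_subset_maximal_t_ideal:
  assumes P: "maximal_t_ideal D P" and S: "finite S" "S \<subseteq> P" "\<not> S \<subseteq> {0}"
  shows "v_closure D S \<subseteq> P"
  using t_closure_iff[OF maximal_t_ideal_submodule[OF P]] S
  unfolding maximal_t_ideal_closed[OF P] by blast

text \<open>Zorn's lemma is applied to the ideals above \<open>I\<close> whose t-closure omits 1.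
  Unions of chains stay in this family because a finite witness \<open>S\<close> already lies in one
  member of the chain.\<close>

lemma maximal_t_ideal_exists:
  assumes "ideal D I" "I \<noteq> {0}" "1 \<notin> t_closure D I"
  obtains P where "maximal_t_ideal D P" "I \<subseteq> P"
proof -
  define \<A> where "\<A> = {J. ideal D J \<and> I \<subseteq> J \<and> 1 \<notin> t_closure D J}"
  have nz: "J \<noteq> {0}" if "J \<in> \<A>" for J
    using that assms(1,2) submodule_zero unfolding \<A>_def ideal_def by blast
  have "\<exists>M\<in>\<A>. \<forall>X\<in>\<A>. M \<subseteq> X \<longrightarrow> X = M"
  proof (rule subset_Zorn_nonempty)
    show "\<A> \<noteq> {}" using assms by (auto simp: \<A>_def)
    fix \<C> assume \<C>: "\<C> \<noteq> {}" "subset.chain \<A> \<C>"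
    then have sub: "J \<in> \<A>" if "J \<in> \<C>" for J using that by (auto simp: subset_chain_def)
    have lin: "J \<subseteq> J' \<or> J' \<subseteq> J" if "J \<in> \<C>" "J' \<in> \<C>" for J J'
      using \<C>(2) that by (auto simp: subset_chain_def)
    have sm: "submodule D J" "J \<subseteq> D" if "J \<in> \<C>" for J
      using sub[OF that] by (auto simp: \<A>_def ideal_def)
    have un: "submodule D (\<Union>\<C>)"
      unfolding submodule_def
    proof (intro conjI ballI)
      show "0 \<in> \<Union>\<C>" using \<C>(1) sm submodule_zero by blast
      show "x + y \<in> \<Union>\<C>" if xy: "x \<in> \<Union>\<C>" "y \<in> \<Union>\<C>" for x y
      proof -
        obtain J where "J \<in> \<C>" "x \<in> J" "y \<in> J" using xy lin by blast
        then show ?thesis using sm submodule_add by blast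
      qed
      show "r * x \<in> \<Union>\<C>" if "r \<in> D" "x \<in> \<Union>\<C>" for r x
        using that sm submodule_scale by blast
    qed
    have "1 \<notin> t_closure D (\<Union>\<C>)"
    proof
      assume "1 \<in> t_closure D (\<Union>\<C>)"
      then obtain S where S: "finite S" "S \<subseteq> \<Union>\<C>" "\<not> S \<subseteq> {0}" "1 \<in> v_closure D S"
        unfolding t_closure_iff[OF un] by blast
      obtain J where J: "J \<in> \<C>" "S \<subseteq> J"
        using finite_subset_Union_chain[OF S(1,2) \<C>] by blast
      then have "1 \<in> t_closure D J" using S sm(1) t_closure_iff by blast
      then show False using sub[OF J(1)] by (simp add: \<A>_def)
    qed
    moreover have "I \<subseteq> \<Union>\<C>" using \<C>(1) sub by (auto simp: \<A>_def)
    ultimately show "\<Union>\<C> \<in> \<A>" using un sm(2) by (auto simp: \<A>_def ideal_def)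
  qed
  then obtain M where M: "M \<in> \<A>" "\<And>X. X \<in> \<A> \<Longrightarrow> M \<subseteq> X \<Longrightarrow> X = M" by blast
  have idM: "ideal D M" and IM: "I \<subseteq> M" and M1: "1 \<notin> t_closure D M"
    using M(1) by (auto simp: \<A>_def)
  \<comment> \<open>By idempotence the t-closure of \<open>M\<close> belongs to the family too, so
    maximality makes \<open>M\<close> a t-ideal.\<close>
  have "M \<subseteq> t_closure D M"
    using t_closure_extensive nz[OF M(1)] idM by (auto simp: ideal_def)
  moreover from this have "t_closure D M \<in> \<A>"
    using ideal_t_closure[OF idM nz[OF M(1)]] t_closure_idem[OF idM nz[OF M(1)]] IM M1
    by (auto simp: \<A>_def)
  ultimately have closed: "t_closure D M = M" using M(2) by blast
  have "maximal_t_ideal D M"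
    unfolding maximal_t_ideal_def t_ideal_def
  proof (intro conjI allI impI)
    show "fractional_ideal D M" by (rule fractional_ideal_if_ideal[OF idM])
    show "M \<noteq> {0}" by (rule nz[OF M(1)])
    show "M \<subset> D" using idM M1 closed one_mem by (auto simp: ideal_def)
    fix Q assume Q: "(fractional_ideal D Q \<and> Q \<noteq> {0} \<and> t_closure D Q = Q) \<and> Q \<subset> D \<and> M \<subseteq> Q"
    then have "submodule D Q" by (simp add: fractional_ideal_def)
    then have "Q \<in> \<A>" using Q IM one_notin_proper_submodule by (auto simp: \<A>_def ideal_def)
    then show "Q = M" using M(2) Q by blast
  qed (rule closed)
  then show ?thesis using that IM by blast
qed

text \<open>If \<open>x\<close> and \<open>y\<close> both lay outside \<open>P\<close>, the ideal
  \<open>P + x D\<close> would have 1 in its t-closure through a finite \<open>S\<close>.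
  Multiplying \<open>S\<close> by \<open>y\<close> lands in \<open>P\<close>, and then
  \<open>y\<close> itself is forced into \<open>P\<close>.\<close>

lemma prime_maximal_t_ideal:
  assumes P: "maximal_t_ideal D P"
  shows "prime_ideal D P"
  unfolding prime_ideal_def
proof (intro conjI ballI impI)
  note sP = maximal_t_ideal_submodule[OF P] and PD = maximal_t_ideal_subset[OF P]
  show "ideal D P" using sP PD by (simp add: ideal_def)
  show "P \<noteq> D" using one_notin_maximal_t_ideal[OF P] one_mem by blast
  fix x y assume xy: "x \<in> D" "y \<in> D" "x * y \<in> P"
  show "x \<in> P \<or> y \<in> P"
  proof (rule ccontr)
    assume "\<not> (x \<in> P \<or> y \<in> P)"
    then have nx: "x \<notin> P" and ny: "y \<notin> P" by auto
    define Q where "Q = {p + r * x | p r. p \<in> P \<and> r \<in> D}"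
    have sQ: "submodule D Q"
      unfolding submodule_def
    proof (intro conjI ballI)
      show "0 \<in> Q" using submodule_zero[OF sP] zero_mem by (force simp: Q_def)
      fix u v assume "u \<in> Q" "v \<in> Q"
      then obtain p r p' r' where "u = p + r * x" "v = p' + r' * x" "p \<in> P" "p' \<in> P" "r \<in> D" "r' \<in> D"
        by (auto simp: Q_def)
      then have "u + v = (p + p') + (r + r') * x" "p + p' \<in> P" "r + r' \<in> D"
        using submodule_add[OF sP] by (auto simp: algebra_simps add_mem)
      then show "u + v \<in> Q" unfolding Q_def by blast
    next
      fix d u assume "d \<in> D" "u \<in> Q"
      then obtain p r where "u = p + r * x" "p \<in> P" "r \<in> D" by (auto simp: Q_def)
      with \<open>d \<in> D\<close> have "d * u = d * p + (d * r) * x" "d * p \<in> P" "d * r \<in> D"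
        using submodule_scale[OF sP] by (auto simp: algebra_simps mult_mem)
      then show "d * u \<in> Q" unfolding Q_def by blast
    qed
    have PQ: "P \<subseteq> Q" using zero_mem by (force simp: Q_def)
    have "x \<in> Q" using submodule_zero[OF sP] one_mem by (force simp: Q_def)
    have "Q \<subseteq> D" using PD xy(1) by (auto simp: Q_def intro!: add_mem mult_mem)
    then have idQ: "ideal D Q" "Q \<noteq> {0}"
      using sQ PQ maximal_t_ideal_nonzero[OF P] submodule_zero[OF sP] by (auto simp: ideal_def)
    have "1 \<in> t_closure D Q"
    proof (rule ccontr)
      assume "1 \<notin> t_closure D Q"
      then obtain M where "maximal_t_ideal D M" "Q \<subseteq> M"
        using maximal_t_ideal_exists[OF idQ] by blast
      then show False using maximal_t_ideal_eqI[OF P] PQ \<open>x \<in> Q\<close> nx by blast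
    qed
    then obtain S where S: "finite S" "S \<subseteq> Q" "\<not> S \<subseteq> {0}" "1 \<in> v_closure D S"
      unfolding t_closure_iff[OF sQ] by blast
    have "y * s \<in> P" if "s \<in> S" for s
    proof -
      obtain p r where "s = p + r * x" "p \<in> P" "r \<in> D" using \<open>s \<in> S\<close> S(2) by (auto simp: Q_def)
      then show ?thesis
        using submodule_add[OF sP submodule_scale[OF sP xy(2)] submodule_scale[OF sP _ xy(3)]]
        by (simp add: algebra_simps)
    qed
    moreover have "y \<noteq> 0" using ny submodule_zero[OF sP] by blast
    ultimately have "v_closure D ((*) y ` S) \<subseteq> P"
      using S by (intro v_closure_subset_maximal_t_ideal[OF P]) auto
    \<comment> \<open>The v-closure is compatible with scaling: \<open>1 \<in> v_closure D S\<close>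
      is multiplied by \<open>y\<close>.\<close>
    moreover have "y \<in> v_closure D ((*) y ` S)"
    proof -
      have "y * u \<in> D" if "u \<in> ideal_inverse D ((*) y ` S)" for u
      proof -
        have "y * u \<in> ideal_inverse D S"
          using that by (auto simp: ideal_inverse_def algebra_simps)
        then show ?thesis using S(4) by (auto simp: one_in_v_closure_iff)
      qed
      then show ?thesis by (simp add: v_closure_def ideal_inverse_def[of _ "ideal_inverse D _"])
    qed
    ultimately show False using ny by blast
  qed
qed

lemma prime_ideal_power:
  assumes "prime_ideal D P" "x \<in> D" "x ^ n \<in> P"
  shows "x \<in> P"
proof -
  have "submodule D P" "P \<subset> D" using assms(1) by (auto simp: prime_ideal_def ideal_def)
  then have "1 \<notin> P" by (rule one_notin_proper_submodule)
  with assms show ?thesis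
    by (induction n) (auto simp: prime_ideal_def power_mem)
qed

lemma prime_ideal_submodule: "prime_ideal D P \<Longrightarrow> submodule D P"
  and prime_ideal_subset: "prime_ideal D P \<Longrightarrow> P \<subseteq> D"
  by (auto simp: prime_ideal_def ideal_def)

lemma one_notin_prime_ideal: "prime_ideal D P \<Longrightarrow> 1 \<notin> P"
  by (intro one_notin_proper_submodule) (auto simp: prime_ideal_def ideal_def)

lemma mult_notin_prime_ideal:
  "prime_ideal D P \<Longrightarrow> s \<in> D \<Longrightarrow> s \<notin> P \<Longrightarrow> t \<in> D \<Longrightarrow> t \<notin> P \<Longrightarrow> s * t \<notin> P"
  by (auto simp: prime_ideal_def)

section \<open>Localizations\<close>

text \<open>Membership is tested by one multiplier \<open>s\<close>. As \<open>P\<close> is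
  arbitrary here, \<open>s \<notin> P\<close> does not give \<open>s \<noteq> 0\<close>, which is
  what allows cancelling \<open>s\<close>.\<close>

lemma localizationI:
  "s * x \<in> D \<Longrightarrow> s \<in> D \<Longrightarrow> s \<notin> P \<Longrightarrow> s \<noteq> 0 \<Longrightarrow> x \<in> localization D P"
  unfolding localization_def mem_Collect_eq by (intro exI[of _ "s * x"] exI[of _ s]) simp

lemma localizationE:
  assumes "prime_ideal D P" "x \<in> localization D P"
  obtains s where "s * x \<in> D" "s \<in> D" "s \<notin> P" "s \<noteq> 0"
proof -
  obtain a s where "x = a / s" "a \<in> D" "s \<in> D" "s \<notin> P"
    using assms(2) by (auto simp: localization_def)
  moreover from this have "s \<noteq> 0"
    using submodule_zero[OF prime_ideal_submodule[OF assms(1)]] by blast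
  ultimately show ?thesis using that[of s] by simp
qed

lemma subset_localization: "prime_ideal D P \<Longrightarrow> D \<subseteq> localization D P"
  by (intro subsetI localizationI[of 1]) (simp_all add: one_mem one_notin_prime_ideal)

lemma domain_localization:
  assumes P: "prime_ideal D P"
  shows "domain_with_quotient_field (localization D P)"
  unfolding domain_with_quotient_field_def
proof (intro conjI ballI allI)
  show "1 \<in> localization D P" using subset_localization[OF P] one_mem by blast
  fix x y assume xy: "x \<in> localization D P" "y \<in> localization D P"
  obtain s where s: "s * x \<in> D" "s \<in> D" "s \<notin> P" "s \<noteq> 0" using localizationE[OF P xy(1)] .
  obtain t where t: "t * y \<in> D" "t \<in> D" "t \<notin> P" "t \<noteq> 0" using localizationE[OF P xy(2)] .
  have st: "s * t \<in> D" "s * t \<notin> P" "s * t \<noteq> 0"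
    using s t mult_mem mult_notin_prime_ideal[OF P] by auto
  have "t * (s * x) - s * (t * y) \<in> D" "(s * x) * (t * y) \<in> D"
    using s t by (simp_all add: diff_mem mult_mem)
  then have "s * t * (x - y) \<in> D" "s * t * (x * y) \<in> D" by (simp_all add: algebra_simps)
  then show "x - y \<in> localization D P" "x * y \<in> localization D P"
    using localizationI st by blast+
next
  fix x
  show "\<exists>a\<in>localization D P. \<exists>b\<in>localization D P. b \<noteq> 0 \<and> x = a / b"
    by (rule fraction_cases[of x]) (use subset_localization[OF P] in blast)
qed

text \<open>Multiplying the individual denominators gives a common one, which stays outside
  \<open>P\<close> by primality.\<close>

lemma finite_subset_localization:
  assumes P: "prime_ideal D P" and S: "finite S" "S \<subseteq> localization D P"
  obtains t where "t \<in> D" "t \<notin> P" "\<And>u. u \<in> S \<Longrightarrow> t * u \<in> D"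
proof -
  have "\<exists>t\<in>D. t \<notin> P \<and> (\<forall>u\<in>S. t * u \<in> D)"
    using S
  proof (induction S)
    case empty
    then show ?case using one_mem one_notin_prime_ideal[OF P] by blast
  next
    case (insert x S)
    then obtain t where t: "t \<in> D" "t \<notin> P" "\<forall>u\<in>S. t * u \<in> D" by auto
    obtain s where s: "s * x \<in> D" "s \<in> D" "s \<notin> P" "s \<noteq> 0"
      using localizationE[OF P] insert.prems by blast
    have "s * t * u \<in> D" if "u \<in> insert x S" for u
    proof -
      have "s * t * u = t * (s * u)" "s * t * u = s * (t * u)" by (simp_all add: algebra_simps)
      then show ?thesis using that s t mult_mem by (metis insert_iff)
    qed
    then show ?case
      using mult_mem[OF s(2) t(1)] mult_notin_prime_ideal[OF P s(2,3) t(1,2)] by blast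
  qed
  then show ?thesis using that by blast
qed

lemma inverse_notin_localization:
  assumes "prime_ideal D P" "a \<in> P" "a \<noteq> 0"
  shows "inverse a \<notin> localization D P"
proof
  assume "inverse a \<in> localization D P"
  then obtain s where "s * inverse a \<in> D" "s \<notin> P" using localizationE[OF assms(1)] by blast
  then show False
    using submodule_scale[OF prime_ideal_submodule[OF assms(1)] _ assms(2), of "s * inverse a"] assms(3)
    by (simp add: mult.assoc)
qed

text \<open>For \<open>u\<close> in the intersection, the ideal of its denominators lies in no
  maximal t-ideal, so 1 is in its t-closure. A finite set of denominators with 1 in its v-closure
  then puts \<open>u\<close> into \<open>D\<close>.\<close>

lemma Inter_localization_maximal_t_ideals:
  "(\<Inter>P\<in>{P. maximal_t_ideal D P}. localization D P) = D"
proof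
  show "D \<subseteq> (\<Inter>P\<in>{P. maximal_t_ideal D P}. localization D P)"
    using subset_localization prime_maximal_t_ideal by blast
  show "(\<Inter>P\<in>{P. maximal_t_ideal D P}. localization D P) \<subseteq> D"
  proof
    fix u assume u: "u \<in> (\<Inter>P\<in>{P. maximal_t_ideal D P}. localization D P)"
    define I where "I = {d \<in> D. d * u \<in> D}"
    have idI: "ideal D I"
      by (auto simp: I_def ideal_def submodule_def zero_mem add_mem mult_mem distrib_right mult.assoc)
    obtain a b where "a \<in> D" "b \<in> D" "b \<noteq> 0" "u = a / b" by (rule fraction_cases)
    then have "b \<in> I" "b \<noteq> 0" by (auto simp: I_def)
    then have "I \<noteq> {0}" by blast
    have "1 \<in> t_closure D I"
    proof (rule ccontr)
      assume "1 \<notin> t_closure D I"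
      then obtain P where P: "maximal_t_ideal D P" "I \<subseteq> P"
        using maximal_t_ideal_exists[OF idI \<open>I \<noteq> {0}\<close>] by blast
      then have "u \<in> localization D P" using u by blast
      then obtain s where "s * u \<in> D" "s \<in> D" "s \<notin> P"
        using localizationE[OF prime_maximal_t_ideal[OF P(1)]] by metis
      then show False using P(2) by (auto simp: I_def)
    qed
    then obtain S where S: "S \<subseteq> I" "1 \<in> v_closure D S"
      using t_closure_iff[of I] idI unfolding ideal_def by blast
    then have "u \<in> ideal_inverse D S" by (auto simp: I_def ideal_inverse_def mult.commute)
    then show "u \<in> D" using S(2) by (auto simp: one_in_v_closure_iff)
  qed
qed

section \<open>Localizations of a PVMD\<close>

lemma hull_pair_subset:
  "submodule D hull {a, b} \<subseteq> {r * a + s * b | r s. r \<in> D \<and> s \<in> D}"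
proof (rule hull_minimal)
  show "{a, b} \<subseteq> {r * a + s * b | r s. r \<in> D \<and> s \<in> D}"
    using zero_mem one_mem by force
  show "submodule D {r * a + s * b | r s. r \<in> D \<and> s \<in> D}"
    unfolding submodule_def
  proof (intro conjI ballI)
    show "0 \<in> {r * a + s * b | r s. r \<in> D \<and> s \<in> D}" using zero_mem by force
    fix x y assume "x \<in> {r * a + s * b | r s. r \<in> D \<and> s \<in> D}"
      "y \<in> {r * a + s * b | r s. r \<in> D \<and> s \<in> D}"
    then obtain r s r' s' where "x = r * a + s * b" "y = r' * a + s' * b"
      "r \<in> D" "s \<in> D" "r' \<in> D" "s' \<in> D" by blast
    then have "x + y = (r + r') * a + (s + s') * b" "r + r' \<in> D" "s + s' \<in> D"
      by (auto simp: algebra_simps add_mem)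
    then show "x + y \<in> {r * a + s * b | r s. r \<in> D \<and> s \<in> D}" by blast
  next
    fix d x assume "d \<in> D" "x \<in> {r * a + s * b | r s. r \<in> D \<and> s \<in> D}"
    then obtain r s where "x = r * a + s * b" "r \<in> D" "s \<in> D" by blast
    then have "d * x = (d * r) * a + (d * s) * b" "d * r \<in> D" "d * s \<in> D"
      using \<open>d \<in> D\<close> by (auto simp: algebra_simps mult_mem)
    then show "d * x \<in> {r * a + s * b | r s. r \<in> D \<and> s \<in> D}" by blast
  qed
qed

text \<open>Write \<open>x = a / b\<close>. The t-invertibility of the ideal \<open>I\<close>
  generated by \<open>a\<close> and \<open>b\<close> prevents the product of \<open>I\<close> with
  its inverse from lying in \<open>P\<close>. So \<open>w * a\<close> or \<open>w * b\<close>
  escapes \<open>P\<close> for some \<open>w\<close>, and it serves as denominator of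
  \<open>inverse x\<close> or of \<open>x\<close>.\<close>

lemma valuation_domain_localization:
  assumes pvmd: "PVMD D" and P: "maximal_t_ideal D P"
  shows "valuation_domain (localization D P)"
  unfolding valuation_domain_def
proof (intro conjI allI impI)
  note pP = prime_maximal_t_ideal[OF P] and sP = maximal_t_ideal_submodule[OF P]
  show "domain_with_quotient_field (localization D P)" by (rule domain_localization[OF pP])
  fix x :: 'k assume "x \<noteq> 0"
  obtain a b where ab: "a \<in> D" "b \<in> D" "b \<noteq> 0" "x = a / b" by (rule fraction_cases)
  then have "a \<noteq> 0" using \<open>x \<noteq> 0\<close> by auto
  define I where "I = submodule D hull {a, b}"
  have abI: "a \<in> I" "b \<in> I" using hull_subset[of "{a, b}" "submodule D"] by (auto simp: I_def)
  have "I \<subseteq> D" using ab submodule_D hull_minimal[of "{a, b}" D] by (auto simp: I_def)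
  then have "ideal D I" "I \<noteq> {0}"
    using submodule_hull abI ab by (auto simp: ideal_def I_def)
  moreover have "finitely_generated D I"
    unfolding finitely_generated_def I_def by (intro exI[of _ "{a, b}"]) simp
  ultimately have tc: "t_closure D (ideal_product D I (ideal_inverse D I)) = D"
    using pvmd by (simp add: PVMD_def)
  have "\<not> {c * w | c w. c \<in> I \<and> w \<in> ideal_inverse D I} \<subseteq> P"
  proof
    assume "{c * w | c w. c \<in> I \<and> w \<in> ideal_inverse D I} \<subseteq> P"
    then have "ideal_product D I (ideal_inverse D I) \<subseteq> P"
      unfolding ideal_product_def using sP by (rule hull_minimal)
    then have "D \<subseteq> P" using t_closure_mono tc maximal_t_ideal_closed[OF P] by metis
    then show False using one_mem one_notin_maximal_t_ideal[OF P] by blast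
  qed
  then obtain c w where cw: "c \<in> I" "w \<in> ideal_inverse D I" "c * w \<notin> P" by blast
  obtain r s where rs: "c = r * a + s * b" "r \<in> D" "s \<in> D"
    using cw(1) hull_pair_subset[of a b] unfolding I_def by blast
  have w: "w * a \<in> D" "w * b \<in> D" using cw(2) abI by (auto simp: ideal_inverse_def)
  have "c * w = r * (w * a) + s * (w * b)" by (simp add: rs algebra_simps)
  then have "w * a \<notin> P \<or> w * b \<notin> P"
    using cw(3) rs submodule_add[OF sP] submodule_scale[OF sP] by metis
  moreover have "w \<noteq> 0" using cw(3) submodule_zero[OF sP] by auto
  ultimately show "x \<in> localization D P \<or> inverse x \<in> localization D P"
    using localizationI[of "w * b" x P] localizationI[of "w * a" "inverse x" P] w ab \<open>a \<noteq> 0\<close>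
    by auto
qed

end

section \<open>Valuation domains of rank one\<close>

text \<open>The maximal ideal when \<open>V\<close> is a valuation domain. Zero is listed separately
  because \<open>inverse 0 = 0\<close> lies in \<open>V\<close>.\<close>

definition nonunits :: "'k::field set \<Rightarrow> 'k set" where
  "nonunits V = {x \<in> V. x = 0 \<or> inverse x \<notin> V}"

lemma valuation_domain_quotient:
  assumes "valuation_domain V" "x / y \<notin> V"
  shows "y / x \<in> V"
proof -
  interpret quotient_domain V
    using assms(1) by unfold_locales (simp add: valuation_domain_def)
  have "x / y \<noteq> 0" using assms(2) zero_mem by metis
  then show ?thesis using assms unfolding valuation_domain_def by (metis inverse_divide)
qed

lemma prime_ideal_nonunits:
  assumes V: "valuation_domain V"
  shows "prime_ideal V (nonunits V)"
proof -
  interpret quotient_domain V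
    using V by unfold_locales (simp add: valuation_domain_def)
  have scale: "r * x \<in> nonunits V" if "r \<in> V" "x \<in> nonunits V" for r x
  proof (cases "r * x = 0")
    case False
    have "inverse (r * x) * r = inverse x" using False by (simp add: field_simps)
    then have "inverse (r * x) \<notin> V" using mult_mem[OF _ that(1), of "inverse (r * x)"] that(2) False
      by (auto simp: nonunits_def simp del: inverse_mult_distrib)
    then show ?thesis using that mult_mem by (auto simp: nonunits_def)
  qed (auto simp: nonunits_def zero_mem)
  have quot: "x + y \<in> nonunits V" if "x \<in> nonunits V" "y \<in> nonunits V" "x / y \<in> V" for x y
  proof (cases "y = 0")
    case False
    then have "x + y = (x / y + 1) * y" by (simp add: field_simps)
    then show ?thesis using scale[OF add_mem[OF that(3) one_mem] that(2)] by simp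
  qed (use that in simp)
  have "x + y \<in> nonunits V" if "x \<in> nonunits V" "y \<in> nonunits V" for x y
    \<comment> \<open>One of \<open>x / y\<close> and \<open>y / x\<close> lies in \<open>V\<close>,
      so the sum is a \<open>V\<close>-multiple of one of the summands.\<close>
    using quot that valuation_domain_quotient[OF V] by (metis add.commute)
  then have "submodule V (nonunits V)"
    using scale by (simp add: submodule_def) (simp add: nonunits_def zero_mem)
  moreover have "1 \<notin> nonunits V" by (simp add: nonunits_def one_mem)
  moreover have "x \<in> nonunits V \<or> y \<in> nonunits V" if "x \<in> V" "y \<in> V" "x * y \<in> nonunits V" for x y
    using that mult_mem[of "inverse x" "inverse y"] by (auto simp: nonunits_def)
  moreover have "nonunits V \<subseteq> V" by (auto simp: nonunits_def)
  ultimately show ?thesis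
    using one_mem unfolding prime_ideal_def ideal_def by blast
qed

text \<open>Rank one means nontrivial and archimedean. The elements divisible by all powers of a
  nonunit \<open>y\<close> form a prime ideal omitting \<open>y\<close>; if it were nonzero, it
  would be a second nonzero prime besides the nonunits. Conversely, the archimedean property puts a
  power of every nonunit into each nonzero prime.\<close>

lemma rank_one_valuation_domain_iff:
  assumes V: "valuation_domain V"
  shows "rank_one_valuation_domain V \<longleftrightarrow>
    V \<noteq> UNIV \<and> (\<forall>y\<in>V. inverse y \<notin> V \<longrightarrow> (\<forall>r. r \<noteq> 0 \<longrightarrow> (\<exists>n. r / y ^ n \<notin> V)))"
    (is "_ \<longleftrightarrow> _ \<and> ?arch")
proof
  interpret quotient_domain V
    using V by unfold_locales (simp add: valuation_domain_def)
  note pN = prime_ideal_nonunits[OF V]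
  show "V \<noteq> UNIV \<and> ?arch" if "rank_one_valuation_domain V"
  proof (intro conjI ballI impI allI)
    obtain P where P: "prime_ideal V P" "P \<noteq> {0}"
      and uniq: "\<And>Q. prime_ideal V Q \<Longrightarrow> Q \<noteq> {0} \<Longrightarrow> Q = P"
      using \<open>rank_one_valuation_domain V\<close> unfolding rank_one_valuation_domain_def by metis
    show "V \<noteq> UNIV"
    proof
      assume "V = UNIV"
      obtain a where "a \<in> P" "a \<noteq> 0" using P submodule_zero[OF prime_ideal_submodule] by blast
      then have "inverse a * a \<in> P"
        using submodule_scale[OF prime_ideal_submodule[OF P(1)]] \<open>V = UNIV\<close> by blast
      then show False using one_notin_prime_ideal[OF P(1)] \<open>a \<noteq> 0\<close> by simp
    qed
    fix y r assume y: "y \<in> V" "inverse y \<notin> V" and r: "(r::'a) \<noteq> 0"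
    have "y \<noteq> 0" using y zero_mem by auto
    show "\<exists>n. r / y ^ n \<notin> V"
    proof (rule ccontr)
      define Q where "Q = {z. \<forall>n. z / y ^ n \<in> V}"
      assume "\<nexists>n. r / y ^ n \<notin> V"
      then have "r \<in> Q" by (simp add: Q_def)
      have "z / y ^ 0 \<in> V" if "z \<in> Q" for z using that unfolding Q_def by blast
      then have "Q \<subseteq> V" by auto
      \<comment> \<open>The exponent 2 shows that \<open>y\<close> is not in
        \<open>Q\<close>.\<close>
      have "y / y ^ 2 = inverse y" using \<open>y \<noteq> 0\<close> by (simp add: field_simps power2_eq_square)
      then have yQ: "y \<notin> Q" using y unfolding Q_def by (metis (mono_tags) mem_Collect_eq)
      have "submodule V Q"
        unfolding submodule_def Q_def
        by (auto simp: zero_mem add_divide_distrib add_mem times_divide_eq_right[symmetric]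
            mult_mem simp del: times_divide_eq_right)
      moreover have "u \<in> Q \<or> v \<in> Q" if "u * v \<in> Q" for u v
      proof (rule ccontr)
        assume "\<not> (u \<in> Q \<or> v \<in> Q)"
        then obtain m n where mn: "u / y ^ m \<notin> V" "v / y ^ n \<notin> V" by (auto simp: Q_def)
        then have "u \<noteq> 0" "v \<noteq> 0" using zero_mem by auto
        have "y ^ m / u \<in> V" "y ^ n / v \<in> V" using valuation_domain_quotient[OF V] mn by blast+
        \<comment> \<open>The exponent exceeds \<open>m + n\<close> by one, so that the product
          formed next equals \<open>inverse y\<close>.\<close>
        moreover have "u * v / y ^ Suc (m + n) \<in> V" using that unfolding Q_def by blast
        ultimately have "(y ^ m / u) * (y ^ n / v) * (u * v / y ^ Suc (m + n)) \<in> V"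
          by (intro mult_mem)
        also have "(y ^ m / u) * (y ^ n / v) * (u * v / y ^ Suc (m + n)) = inverse y"
          using \<open>u \<noteq> 0\<close> \<open>v \<noteq> 0\<close> \<open>y \<noteq> 0\<close> by (simp add: field_simps power_add)
        finally show False using y by blast
      qed
      ultimately have "prime_ideal V Q"
        using \<open>Q \<subseteq> V\<close> yQ y(1) by (auto simp: prime_ideal_def ideal_def)
      moreover have "Q \<noteq> {0}" using \<open>r \<in> Q\<close> r by blast
      moreover have "y \<in> nonunits V" using y by (simp add: nonunits_def)
      then have "nonunits V \<noteq> {0}" using \<open>y \<noteq> 0\<close> by blast
      ultimately have "Q = nonunits V" using uniq pN by metis
      then show False using yQ \<open>y \<in> nonunits V\<close> by blast
    qed
  qed
  show "rank_one_valuation_domain V" if arch: "V \<noteq> UNIV \<and> ?arch"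
    unfolding rank_one_valuation_domain_def
  proof (intro conjI V ex1I[of _ "nonunits V"] pN)
    obtain x where "x \<notin> V" using arch by blast
    then have "x \<noteq> 0" using zero_mem by auto
    then have "inverse x \<in> V" using V \<open>x \<notin> V\<close> by (auto simp: valuation_domain_def)
    then have "inverse x \<in> nonunits V" using \<open>x \<notin> V\<close> by (simp add: nonunits_def)
    then show "nonunits V \<noteq> {0}" using \<open>x \<noteq> 0\<close> by force
    fix Q assume Q: "prime_ideal V Q \<and> Q \<noteq> {0}"
    then have sQ: "submodule V Q" "Q \<subseteq> V" "1 \<notin> Q"
      using prime_ideal_submodule prime_ideal_subset one_notin_prime_ideal by blast+
    obtain r where r: "r \<in> Q" "r \<noteq> 0" using Q submodule_zero[OF sQ(1)] by blast
    show "Q = nonunits V"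
    proof
      show "Q \<subseteq> nonunits V"
      proof
        fix z assume z: "z \<in> Q"
        have "inverse z \<notin> V" if "z \<noteq> 0"
          using submodule_scale[OF sQ(1) _ z, of "inverse z"] sQ(3) that by auto
        then show "z \<in> nonunits V" using z sQ(2) by (auto simp: nonunits_def)
      qed
      show "nonunits V \<subseteq> Q"
      proof
        fix y assume y: "y \<in> nonunits V"
        show "y \<in> Q"
        proof (cases "y = 0")
          case False
          then have "y \<in> V" "inverse y \<notin> V" using y by (auto simp: nonunits_def)
          then obtain n where "r / y ^ n \<notin> V" using arch r by blast
          then have "y ^ n / r * r \<in> Q"
            using valuation_domain_quotient[OF V] submodule_scale[OF sQ(1) _ r(1)] by blast
          then have "y ^ n \<in> Q" using r by simp
          then show ?thesis using prime_ideal_power Q \<open>y \<in> V\<close> by blast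
        qed (simp add: submodule_zero[OF sQ(1)])
      qed
    qed
  qed
qed

text \<open>Divisibility in \<open>V\<close> is total, so a finite set has an element dividing all
  others; this generates the same \<open>V\<close>-module as the whole set.\<close>

lemma valuation_domain_finite_set:
  assumes V: "valuation_domain V" and S: "finite S" "\<not> S \<subseteq> {0}"
  obtains b where "b \<in> S" "b \<noteq> 0" "\<And>c. c \<in> S \<Longrightarrow> c / b \<in> V"
proof -
  interpret quotient_domain V
    using V by unfold_locales (simp add: valuation_domain_def)
  have "finite (S - {0})" "S - {0} \<noteq> {}" using S by auto
  then have "\<exists>b\<in>S - {0}. \<forall>c\<in>S - {0}. c / b \<in> V"
  proof (induction rule: finite_ne_induct)
    case (singleton x)
    \<comment> \<open>The induction does not remember that \<open>x\<close> is nonzero; for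
      \<open>x = 0\<close> the convention \<open>0 / 0 = 0\<close> settles the case.\<close>
    then show ?case using one_mem zero_mem by (cases "x = 0") auto
  next
    case (insert x F)
    then obtain b where b: "b \<in> F" "\<forall>c\<in>F. c / b \<in> V" by blast
    show ?case
    proof (cases "x / b \<in> V")
      case True
      then show ?thesis using b by blast
    next
      case False
      then have "b / x \<in> V" "b \<noteq> 0" "x \<noteq> 0"
        using valuation_domain_quotient[OF V] zero_mem by auto
      have "c / x \<in> V" if "c \<in> F" for c
        using mult_mem[OF bspec[OF b(2) that] \<open>b / x \<in> V\<close>] \<open>b \<noteq> 0\<close> by simp
      moreover have "x / x \<in> V" using one_mem \<open>x \<noteq> 0\<close> by simp
      ultimately show ?thesis by blast
    qed
  qed
  then show ?thesis using that zero_mem by (metis Diff_iff divide_eq_0_iff insertCI singletonD)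
qed

section \<open>Generalized Krull domains\<close>

lemma completely_integrally_closedD:
  "completely_integrally_closed D \<Longrightarrow> r \<in> D \<Longrightarrow> r \<noteq> 0 \<Longrightarrow> (\<And>n. r * x ^ n \<in> D) \<Longrightarrow> x \<in> D"
  unfolding completely_integrally_closed_def by blast

lemma rank_one_valuation_domain_completely_integrally_closed:
  assumes V: "rank_one_valuation_domain V" and r: "r \<noteq> 0" and x: "\<And>n. n \<ge> 1 \<Longrightarrow> r * x ^ n \<in> V"
    and "r \<in> V"
  shows "x \<in> V"
proof (rule ccontr)
  assume "x \<notin> V"
  have vV: "valuation_domain V" using V by (simp add: rank_one_valuation_domain_def)
  interpret quotient_domain V
    using vV by unfold_locales (simp add: valuation_domain_def)
  have "x \<noteq> 0" using \<open>x \<notin> V\<close> zero_mem by auto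
  then have "inverse x \<in> V" "inverse (inverse x) \<notin> V"
    using vV \<open>x \<notin> V\<close> by (auto simp: valuation_domain_def)
  then obtain n where "r / inverse x ^ n \<notin> V"
    using V r unfolding rank_one_valuation_domain_iff[OF vV] by blast
  then have "r * x ^ n \<notin> V" by (simp add: divide_inverse power_inverse)
  \<comment> \<open>The archimedean exponent may be 0, which the assumption on positive powers
    misses; \<open>r \<in> V\<close> covers it.\<close>
  then show False using x[of n] \<open>r \<in> V\<close> by (cases "n = 0") auto
qed

context quotient_domain
begin

text \<open>A maximal t-ideal contains an ideal as soon as it contains generators of it, so potency
  can be witnessed by a finite set.\<close>

lemma potentE:
  assumes "potent D P"
  obtains S where "finite S" "\<not> S \<subseteq> {0}" "S \<subseteq> P"
    "\<And>Q. maximal_t_ideal D Q \<Longrightarrow> S \<subseteq> Q \<Longrightarrow> Q = P"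
proof -
  obtain S where S: "finite S" "submodule D hull S \<noteq> {0}" "submodule D hull S \<subseteq> P"
    "\<And>Q. maximal_t_ideal D Q \<Longrightarrow> submodule D hull S \<subseteq> Q \<Longrightarrow> Q = P"
    using assms unfolding potent_def finitely_generated_def by blast
  have "\<not> S \<subseteq> {0}" using S(2) hull_subset_zero by blast
  moreover have "S \<subseteq> P" using S(3) hull_subset[of S "submodule D"] by blast
  moreover have "Q = P" if "maximal_t_ideal D Q" "S \<subseteq> Q" for Q
    using S(4)[OF that(1)] hull_minimal[of S Q "submodule D"] that maximal_t_ideal_submodule by blast
  ultimately show ?thesis using that S(1) by blast
qed

lemma potentI:
  assumes P: "maximal_t_ideal D P" and S: "finite S" "\<not> S \<subseteq> {0}" "S \<subseteq> P"
    and uniq: "\<And>Q. maximal_t_ideal D Q \<Longrightarrow> S \<subseteq> Q \<Longrightarrow> Q = P"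
  shows "potent D P"
proof -
  have sub: "S \<subseteq> submodule D hull S" by (rule hull_subset)
  have "submodule D hull S \<subseteq> P" using S(3) maximal_t_ideal_submodule[OF P] by (rule hull_minimal)
  moreover from this have "ideal D (submodule D hull S)"
    using submodule_hull maximal_t_ideal_subset[OF P] by (auto simp: ideal_def)
  moreover have "submodule D hull S \<noteq> {0}" using sub S(2) by blast
  ultimately show ?thesis
    using uniq sub S(1) unfolding potent_def finitely_generated_def
    by (intro exI[of _ "submodule D hull S"]) blast
qed

section \<open>Rank one and local finiteness from potency\<close>

lemma rank_one_localization:
  assumes pvmd: "PVMD D" and cic: "completely_integrally_closed D"
    and P: "maximal_t_ideal D P" and pot: "potent D P"
  shows "rank_one_valuation_domain (localization D P)"
proof -
  define V where "V = localization D P"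
  note pP = prime_maximal_t_ideal[OF P]
  note sP = maximal_t_ideal_submodule[OF P] and PD = maximal_t_ideal_subset[OF P]
  have vV: "valuation_domain V"
    unfolding V_def by (rule valuation_domain_localization[OF pvmd P])
  interpret V: quotient_domain V
    using vV by unfold_locales (simp add: valuation_domain_def)
  have DV: "D \<subseteq> V" unfolding V_def by (rule subset_localization[OF pP])
  have "V \<noteq> UNIV"
  proof -
    obtain a where "a \<in> P" "a \<noteq> 0" using maximal_t_ideal_nonzero[OF P] submodule_zero[OF sP] by blast
    then show ?thesis using inverse_notin_localization[OF pP] unfolding V_def by blast
  qed
  moreover have "\<exists>n. r / y ^ n \<notin> V" if y: "y \<in> V" "inverse y \<notin> V" and r: "r \<noteq> 0" for y r
  proof (rule ccontr)
    assume div: "\<nexists>n. r / y ^ n \<notin> V"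
    have "y \<noteq> 0" using y V.zero_mem by auto
    \<comment> \<open>Multiplying by the unit \<open>s\<close> of \<open>V\<close> replaces
      \<open>y\<close> by an element \<open>a\<close> of \<open>D\<close>; it lies in
      \<open>P\<close>, since otherwise \<open>inverse y\<close> would be in
      \<open>V\<close>.\<close>
    obtain s where s: "s * y \<in> D" "s \<in> D" "s \<notin> P" "s \<noteq> 0"
      using localizationE[OF pP] y(1) unfolding V_def by blast
    define a where "a = s * y"
    have "a \<noteq> 0" using \<open>y \<noteq> 0\<close> s by (simp add: a_def)
    have "a \<in> P"
    proof (rule ccontr)
      assume "a \<notin> P"
      moreover have "a * inverse y = s" using \<open>y \<noteq> 0\<close> by (simp add: a_def)
      then have "a * inverse y \<in> D" "a \<in> D" using s by (simp_all only: a_def)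
      ultimately have "inverse y \<in> V" unfolding V_def
        using \<open>a \<noteq> 0\<close> by (intro localizationI[of a])
      then show False using y by blast
    qed
    \<comment> \<open>Complete integral closure asks for a multiplier in \<open>D\<close>, so
      \<open>r\<close> gives way to its numerator \<open>c = b * r\<close>, which is still divisible
      in \<open>V\<close> by all powers of \<open>a\<close>.\<close>
    obtain c b where cb: "c \<in> D" "b \<in> D" "b \<noteq> 0" "r = c / b" by (rule fraction_cases)
    then have "c \<noteq> 0" using r by auto
    have inv_s: "inverse s \<in> V"
      unfolding V_def using s one_mem by (intro localizationI[of s]) auto
    have ca: "c / a ^ n \<in> V" for n
    proof -
      have "c / a ^ n = b * (r / y ^ n) * inverse s ^ n"
        using cb by (simp add: a_def power_mult_distrib field_simps)
      moreover have "r / y ^ n \<in> V" "b \<in> V" using div cb DV by blast+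
      ultimately show ?thesis using inv_s by (simp only: V.mult_mem V.power_mem)
    qed
    obtain S where S: "finite S" "S \<subseteq> P" "\<And>Q. maximal_t_ideal D Q \<Longrightarrow> S \<subseteq> Q \<Longrightarrow> Q = P"
      using potentE[OF pot] by metis
    have "ideal_inverse D (insert a S) \<subseteq> D"
    proof
      fix w assume w: "w \<in> ideal_inverse D (insert a S)"
      have "c * w ^ n \<in> localization D Q" if Q: "maximal_t_ideal D Q" for Q n
      proof (cases "Q = P")
        case True
        have "w * a \<in> V" using w DV by (auto simp: ideal_inverse_def)
        moreover have "c * w ^ n = (c / a ^ n) * (w * a) ^ n"
          using \<open>a \<noteq> 0\<close> by (simp add: power_mult_distrib)
        ultimately show ?thesis
          using V.mult_mem[OF ca V.power_mem] True unfolding V_def by metis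
      next
        case False
        \<comment> \<open>Here \<open>S\<close> enters: only \<open>P\<close> contains it, so some
          \<open>t \<in> S\<close> is available as a denominator of \<open>w\<close> at
          \<open>Q\<close>.\<close>
        then obtain t where t: "t \<in> S" "t \<notin> Q" using S(3)[OF Q] by blast
        note pQ = prime_maximal_t_ideal[OF Q]
        interpret Q: quotient_domain "localization D Q"
          by unfold_locales (rule domain_localization[OF pQ])
        have "t \<in> D" "t * w \<in> D" "t \<noteq> 0"
          using t S(2) PD w submodule_zero[OF maximal_t_ideal_submodule[OF Q]]
          by (auto simp: ideal_inverse_def mult.commute)
        then have "w \<in> localization D Q" using t by (intro localizationI[of t])
        moreover have "c \<in> localization D Q" using cb subset_localization[OF pQ] by blast
        ultimately show ?thesis by (simp add: Q.mult_mem Q.power_mem)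
      qed
      then have "c * w ^ n \<in> D" for n
        using Inter_localization_maximal_t_ideals by blast
      then show "w \<in> D"
        using completely_integrally_closedD[OF cic cb(1) \<open>c \<noteq> 0\<close>] by blast
    qed
    then have "1 \<in> v_closure D (insert a S)" by (simp add: one_in_v_closure_iff)
    moreover have "v_closure D (insert a S) \<subseteq> P"
      using S \<open>a \<in> P\<close> \<open>a \<noteq> 0\<close> by (intro v_closure_subset_maximal_t_ideal[OF P]) auto
    ultimately show False using one_notin_maximal_t_ideal[OF P] by blast
  qed
  ultimately show ?thesis
    using rank_one_valuation_domain_iff[OF vV] unfolding V_def by blast
qed

lemma finite_maximal_t_ideals_containing:
  assumes rank: "\<And>P. maximal_t_ideal D P \<Longrightarrow> rank_one_valuation_domain (localization D P)"
    and pot: "\<And>P. maximal_t_ideal D P \<Longrightarrow> potent D P"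
    and x: "x \<in> D" "x \<noteq> 0"
  shows "finite {P. maximal_t_ideal D P \<and> x \<in> P}"
proof -
  define good where "good B \<longleftrightarrow> B \<subseteq> D \<and> finite {Q. maximal_t_ideal D Q \<and> B \<subseteq> Q}" for B
  define A where "A = {y \<in> D. \<exists>B. good B \<and> (\<forall>b\<in>B. y * b / x \<in> D)}"
  \<comment> \<open>A prime containing all products contains one of the two factors, so finiteness
    survives multiplication.\<close>
  have good_mult: "good {b * c | b c. b \<in> B \<and> c \<in> C}" if "good B" "good C" for B C
  proof -
    have "B \<subseteq> Q \<or> C \<subseteq> Q" if Q: "maximal_t_ideal D Q" "{b * c | b c. b \<in> B \<and> c \<in> C} \<subseteq> Q" for Q
    proof (rule ccontr)
      assume "\<not> (B \<subseteq> Q \<or> C \<subseteq> Q)"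
      then obtain b c where "b \<in> B" "b \<notin> Q" "c \<in> C" "c \<notin> Q" by blast
      moreover from this have "b * c \<in> Q" "b \<in> D" "c \<in> D"
        using Q(2) \<open>good B\<close> \<open>good C\<close> by (auto simp: good_def)
      ultimately show False
        using mult_notin_prime_ideal[OF prime_maximal_t_ideal[OF Q(1)]] by blast
    qed
    then have "{Q. maximal_t_ideal D Q \<and> {b * c | b c. b \<in> B \<and> c \<in> C} \<subseteq> Q} \<subseteq>
      {Q. maximal_t_ideal D Q \<and> B \<subseteq> Q} \<union> {Q. maximal_t_ideal D Q \<and> C \<subseteq> Q}" by blast
    moreover have "{b * c | b c. b \<in> B \<and> c \<in> C} \<subseteq> D"
      using that mult_mem by (auto simp: good_def)
    ultimately show ?thesis using that unfolding good_def by (meson finite_UnI finite_subset)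
  qed
  have good_one: "good {1}"
  proof -
    have "{Q. maximal_t_ideal D Q \<and> {1} \<subseteq> Q} = {}" using one_notin_maximal_t_ideal by blast
    then show ?thesis using one_mem unfolding good_def by (metis empty_subsetI finite.emptyI insert_subset)
  qed
  have common: "\<exists>B. good B \<and> (\<forall>y\<in>S. \<forall>b\<in>B. y * b / x \<in> D)" if "finite S" "S \<subseteq> A" for S
    using that
  proof (induction S)
    case empty
    then show ?case using good_one by blast
  next
    case (insert z S)
    then obtain B where B: "good B" "\<forall>y\<in>S. \<forall>b\<in>B. y * b / x \<in> D" by auto
    obtain C where C: "good C" "\<forall>c\<in>C. z * c / x \<in> D" using insert.prems by (auto simp: A_def)
    have "y * (b * c) / x \<in> D" if "y \<in> insert z S" "b \<in> B" "c \<in> C" for y b c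
    proof -
      have "b \<in> D" "c \<in> D" using that B C by (auto simp: good_def)
      have "y * (b * c) / x = (y * b / x) * c" "y * (b * c) / x = b * (y * c / x)" by simp_all
      then show ?thesis using that B C mult_mem \<open>b \<in> D\<close> \<open>c \<in> D\<close> by (metis insert_iff)
    qed
    then show ?case using good_mult[OF B(1) C(1)] by blast
  qed
  have idA: "ideal D A"
    unfolding ideal_def submodule_def
  proof (intro conjI ballI)
    show "A \<subseteq> D" by (auto simp: A_def)
    show "0 \<in> A" using good_one zero_mem by (auto simp: A_def)
    show "y + z \<in> A" if yz: "y \<in> A" "z \<in> A" for y z
    proof -
      obtain B where B: "good B" "\<forall>u\<in>{y, z}. \<forall>b\<in>B. u * b / x \<in> D"
        using common[of "{y, z}"] yz by auto
      have "(y + z) * b / x \<in> D" if "b \<in> B" for b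
        using add_mem[of "y * b / x" "z * b / x"] B that by (simp add: distrib_right add_divide_distrib)
      then show ?thesis using B(1) yz add_mem by (auto simp: A_def)
    qed
    show "r * y \<in> A" if r: "r \<in> D" and "y \<in> A" for r y
    proof -
      obtain B where B: "good B" "\<forall>b\<in>B. y * b / x \<in> D" "y \<in> D" using \<open>y \<in> A\<close> by (auto simp: A_def)
      have "r * y * b / x \<in> D" if "b \<in> B" for b
        using mult_mem[OF r, of "y * b / x"] B that by (simp add: mult.assoc)
      then show ?thesis using B r mult_mem by (auto simp: A_def)
    qed
  qed
  have "x \<in> A" using x good_one one_mem by (auto simp: A_def)
  then have "A \<noteq> {0}" using x by blast
  have notsub: "\<not> A \<subseteq> P" if P: "maximal_t_ideal D P" for P
  proof -
    define V where "V = localization D P"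
    note pP = prime_maximal_t_ideal[OF P]
    have rV: "rank_one_valuation_domain V" using rank[OF P] by (simp add: V_def)
    then have vV: "valuation_domain V" by (simp add: rank_one_valuation_domain_def)
    interpret V: quotient_domain V
      using vV by unfold_locales (simp add: valuation_domain_def)
    obtain S where S: "finite S" "S \<subseteq> P" "\<And>Q. maximal_t_ideal D Q \<Longrightarrow> S \<subseteq> Q \<Longrightarrow> Q = P"
      using potentE[OF pot[OF P]] by metis
    have SD: "S \<subseteq> D" using S(2) maximal_t_ideal_subset[OF P] by blast
    have "\<exists>n. s ^ n / x \<in> V" if s: "s \<in> S" for s
    proof (cases "s = 0")
      case True
      \<comment> \<open>The exponent 1 is chosen because \<open>0 ^ 0 = 1\<close>.\<close>
      then show ?thesis using V.zero_mem by (intro exI[of _ 1]) simp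
    next
      case False
      have "s \<in> V" using s SD subset_localization[OF pP] by (auto simp: V_def)
      moreover have "inverse s \<notin> V"
        using inverse_notin_localization[OF pP] s S(2) False by (auto simp: V_def)
      ultimately obtain n where "x / s ^ n \<notin> V"
        using rV x unfolding rank_one_valuation_domain_iff[OF vV] by blast
      then show ?thesis using valuation_domain_quotient[OF vV] by blast
    qed
    then obtain n where n: "\<And>s. s \<in> S \<Longrightarrow> s ^ n s / x \<in> V" by metis
    \<comment> \<open>Some power of each \<open>s\<close> is a multiple of \<open>x\<close> in
      \<open>V\<close>; the common denominator \<open>t\<close> makes this divisibility hold in
      \<open>D\<close>, so \<open>t\<close> is the element of \<open>A\<close> outside
      \<open>P\<close>.\<close>
    obtain t where t: "t \<in> D" "t \<notin> P" "\<And>u. u \<in> (\<lambda>s. s ^ n s / x) ` S \<Longrightarrow> t * u \<in> D"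
      using finite_subset_localization[OF pP, of "(\<lambda>s. s ^ n s / x) ` S"] S(1) n
      unfolding V_def by blast
    \<comment> \<open>Primes cannot distinguish \<open>s\<close> from its powers, so the set of
      powers is still contained in no maximal t-ideal but \<open>P\<close>.\<close>
    have "Q = P" if Q: "maximal_t_ideal D Q" "(\<lambda>s. s ^ n s) ` S \<subseteq> Q" for Q
      using prime_ideal_power[OF prime_maximal_t_ideal[OF Q(1)]] Q SD by (intro S(3)) auto
    then have "{Q. maximal_t_ideal D Q \<and> (\<lambda>s. s ^ n s) ` S \<subseteq> Q} \<subseteq> {P}" by blast
    moreover have "(\<lambda>s. s ^ n s) ` S \<subseteq> D" using SD power_mem by blast
    ultimately have "good ((\<lambda>s. s ^ n s) ` S)" unfolding good_def by (meson finite.simps finite_subset)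
    moreover have "\<forall>b\<in>(\<lambda>s. s ^ n s) ` S. t * b / x \<in> D" using t(3) by fastforce
    ultimately have "t \<in> A" using t(1) unfolding A_def by blast
    then show ?thesis using t(2) by blast
  qed
  have "1 \<in> t_closure D A"
    using maximal_t_ideal_exists[OF idA \<open>A \<noteq> {0}\<close>] notsub by blast
  then obtain S where S: "finite S" "S \<subseteq> A" "1 \<in> v_closure D S"
    using t_closure_iff[of A] idA unfolding ideal_def by blast
  obtain B where B: "good B" "\<forall>y\<in>S. \<forall>b\<in>B. y * b / x \<in> D" using common[OF S(1,2)] by blast
  \<comment> \<open>Since \<open>b / x\<close> multiplies \<open>S\<close> into \<open>D\<close> and
    \<open>1 \<in> v_closure D S\<close>, the factor \<open>y\<close> drops out: \<open>x\<close>
    divides all of \<open>B\<close>.\<close>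
  have "b / x \<in> D" if "b \<in> B" for b
  proof -
    have "b / x \<in> ideal_inverse D S"
      using B(2) that by (auto simp: ideal_inverse_def mult.commute)
    then show ?thesis using S(3) by (auto simp: one_in_v_closure_iff)
  qed
  then have "B \<subseteq> Q" if "maximal_t_ideal D Q" "x \<in> Q" for Q
    using submodule_scale[OF maximal_t_ideal_submodule[OF that(1)] _ that(2)] x(2)
    by (metis nonzero_divide_eq_eq subsetI)
  then have "{P. maximal_t_ideal D P \<and> x \<in> P} \<subseteq> {Q. maximal_t_ideal D Q \<and> B \<subseteq> Q}" by blast
  then show ?thesis using B(1) finite_subset unfolding good_def by blast
qed

section \<open>Essential primes as t-ideals\<close>

text \<open>A finite \<open>S \<subseteq> P\<close> has an element \<open>b\<close> dividing all of
  it in the localization. Clearing denominators by some \<open>t \<notin> P\<close> puts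
  \<open>t / b\<close> into the inverse of \<open>S\<close>, so \<open>y \<in> v_closure D S\<close>
  gives \<open>y * t \<in> P\<close> and thus \<open>y \<in> P\<close>.\<close>

lemma t_ideal_if_valuation_domain_localization:
  assumes P: "prime_ideal D P" "P \<noteq> {0}" and V: "valuation_domain (localization D P)"
  shows "t_ideal D P"
  unfolding t_ideal_def
proof (intro conjI P(2))
  note sP = prime_ideal_submodule[OF P(1)] and PD = prime_ideal_subset[OF P(1)]
  show "fractional_ideal D P" using P(1) by (simp add: fractional_ideal_if_ideal prime_ideal_def)
  show "t_closure D P = P"
  proof
    show "P \<subseteq> t_closure D P" by (rule t_closure_extensive[OF sP P(2)])
    show "t_closure D P \<subseteq> P"
    proof
      fix y assume "y \<in> t_closure D P"
      then obtain S where S: "finite S" "S \<subseteq> P" "\<not> S \<subseteq> {0}" "y \<in> v_closure D S"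
        unfolding t_closure_iff[OF sP] by blast
      obtain b where b: "b \<in> S" "b \<noteq> 0" "\<And>c. c \<in> S \<Longrightarrow> c / b \<in> localization D P"
        using valuation_domain_finite_set[OF V S(1,3)] by blast
      obtain t where t: "t \<in> D" "t \<notin> P" "\<And>u. u \<in> (\<lambda>c. c / b) ` S \<Longrightarrow> t * u \<in> D"
        using finite_subset_localization[OF P(1), of "(\<lambda>c. c / b) ` S"] S(1) b(3) by blast
      have "t / b \<in> ideal_inverse D S" using t(3) by (fastforce simp: ideal_inverse_def)
      then have "y * (t / b) \<in> D"
        using S(4) by (auto simp: v_closure_def ideal_inverse_def[of _ "ideal_inverse D S"])
      then have "y * (t / b) * b \<in> P" using submodule_scale[OF sP] b S(2) by blast
      then have "y * t \<in> P" using b by simp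
      moreover have "y \<in> D" using v_closure_subset_D[of S] S PD by blast
      ultimately show "y \<in> P" using mult_notin_prime_ideal[OF P(1)] t by blast
    qed
  qed
qed

section \<open>The two implications\<close>

text \<open>The defining family consists of all maximal t-ideals; if \<open>D\<close> is the whole
  field it is empty, in line with the convention for the empty intersection.\<close>

lemma generalized_krull_domain_if_potent:
  assumes "PVMD D" "completely_integrally_closed D"
    and pot: "\<And>P. maximal_t_ideal D P \<Longrightarrow> potent D P"
  shows "generalized_krull_domain D"
proof -
  have rank: "rank_one_valuation_domain (localization D P)" if "maximal_t_ideal D P" for P
    using rank_one_localization[OF assms(1,2) that pot[OF that]] .
  then show ?thesis
    unfolding generalized_krull_domain_def
    using prime_maximal_t_ideal Inter_localization_maximal_t_ideals
      finite_maximal_t_ideals_containing[OF rank pot]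
    by (intro exI[of _ "{P. maximal_t_ideal D P}"]) auto
qed

text \<open>Rank one valuation domains are completely integrally closed, and the property passes to
  their intersection.\<close>

lemma generalized_krull_domain_completely_integrally_closed:
  assumes "generalized_krull_domain D"
  shows "completely_integrally_closed D"
proof -
  obtain F where "\<forall>P\<in>F. prime_ideal D P \<and> rank_one_valuation_domain (localization D P)"
    and DF: "D = (\<Inter>P\<in>F. localization D P)"
    using assms unfolding generalized_krull_domain_def by (elim exE conjE)
  then have F: "\<And>P. P \<in> F \<Longrightarrow> prime_ideal D P"
    "\<And>P. P \<in> F \<Longrightarrow> rank_one_valuation_domain (localization D P)"
    by blast+
  show ?thesis
    unfolding completely_integrally_closed_def
  proof (intro allI impI)
    fix x assume "\<exists>r\<in>D. r \<noteq> 0 \<and> (\<forall>n\<ge>1. r * x ^ n \<in> D)"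
    then obtain r where r: "r \<in> D" "r \<noteq> 0" "\<forall>n\<ge>1. r * x ^ n \<in> D" by blast
    have "x \<in> localization D P" if "P \<in> F" for P
    proof (rule rank_one_valuation_domain_completely_integrally_closed[OF F(2)[OF that] r(2)])
      note sub = subset_localization[OF F(1)[OF that]]
      show "r \<in> localization D P" using r(1) sub by blast
      show "r * x ^ n \<in> localization D P" if "n \<ge> 1" for n using r(3) that sub by blast
    qed
    then show "x \<in> D" using DF by (metis INT_I)
  qed
qed

lemma generalized_krull_domain_potent:
  assumes "generalized_krull_domain D" and P: "maximal_t_ideal D P"
  shows "potent D P"
proof -
  obtain F where "\<forall>P\<in>F. prime_ideal D P \<and> rank_one_valuation_domain (localization D P)"
    and DF: "D = (\<Inter>P\<in>F. localization D P)"
    and "\<forall>x\<in>D. x \<noteq> 0 \<and> inverse x \<notin> D \<longrightarrow> finite {P \<in> F. x \<in> P}"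
    using assms(1) unfolding generalized_krull_domain_def by (elim exE conjE)
  then have F: "\<And>P. P \<in> F \<Longrightarrow> prime_ideal D P"
    "\<And>P. P \<in> F \<Longrightarrow> rank_one_valuation_domain (localization D P)"
    and fin: "\<And>x. x \<in> D \<Longrightarrow> x \<noteq> 0 \<Longrightarrow> inverse x \<notin> D \<Longrightarrow> finite {P \<in> F. x \<in> P}"
    by blast+
  have finF: "finite {Q \<in> F. x \<in> Q}" if x: "x \<in> M" "x \<noteq> 0" and M: "maximal_t_ideal D M" for x M
  proof (intro fin)
    note sM = maximal_t_ideal_submodule[OF M]
    show "x \<in> D" using x maximal_t_ideal_subset[OF M] by blast
    show "inverse x \<notin> D"
      using submodule_scale[OF sM _ x(1), of "inverse x"] one_notin_maximal_t_ideal[OF M] x(2) by auto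
  qed (rule x(2))
  have in_F: "M \<in> F" if M: "maximal_t_ideal D M" for M
  proof -
    obtain x where x: "x \<in> M" "x \<noteq> 0"
      using maximal_t_ideal_nonzero[OF M] submodule_zero[OF maximal_t_ideal_submodule[OF M]] by blast
    have "\<exists>Q\<in>F. x \<in> Q \<and> M \<subseteq> Q"
    proof (rule ccontr)
      assume "\<not> (\<exists>Q\<in>F. x \<in> Q \<and> M \<subseteq> Q)"
      \<comment> \<open>Only finitely many \<open>Q \<in> F\<close> contain \<open>x\<close>, so
        choosing one \<open>y Q\<close> for each still gives a finite set. Together with
        \<open>x\<close>, which handles the remaining members of \<open>F\<close>, it lies in no
        member of \<open>F\<close>.\<close>
      then have "\<forall>Q\<in>{Q \<in> F. x \<in> Q}. \<exists>y. y \<in> M \<and> y \<notin> Q" by blast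
      then obtain y where y: "\<And>Q. Q \<in> F \<Longrightarrow> x \<in> Q \<Longrightarrow> y Q \<in> M \<and> y Q \<notin> Q"
        unfolding bchoice_iff by blast
      define S where "S = insert x (y ` {Q \<in> F. x \<in> Q})"
      have S: "finite S" "S \<subseteq> M" "\<not> S \<subseteq> {0}" using finF[OF x M] x y by (auto simp: S_def)
      have "ideal_inverse D S \<subseteq> D"
      proof
        fix u assume u: "u \<in> ideal_inverse D S"
        have "u \<in> localization D Q" if Q: "Q \<in> F" for Q
        proof -
          have "\<exists>s\<in>S. s \<notin> Q" using y[OF Q] Q by (cases "x \<in> Q") (auto simp: S_def)
          then obtain s where s: "s \<in> S" "s \<notin> Q" by blast
          then have "s \<noteq> 0" using submodule_zero[OF prime_ideal_submodule[OF F(1)[OF Q]]] by auto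
          then show ?thesis
            using s u S(2) maximal_t_ideal_subset[OF M]
            by (intro localizationI[of s]) (auto simp: ideal_inverse_def mult.commute)
        qed
        then show "u \<in> D" using DF by (metis INT_I)
      qed
      then have "1 \<in> v_closure D S" by (simp add: one_in_v_closure_iff)
      then show False
        using v_closure_subset_maximal_t_ideal[OF M S] one_notin_maximal_t_ideal[OF M] by blast
    qed
    then obtain Q where Q: "Q \<in> F" "x \<in> Q" "M \<subseteq> Q" by blast
    \<comment> \<open>As a t-ideal containing the maximal t-ideal \<open>M\<close>, the prime
      \<open>Q\<close> can only be \<open>M\<close>.\<close>
    have "t_ideal D Q"
      using F[OF Q(1)] Q(2) x(2) unfolding rank_one_valuation_domain_def
      by (intro t_ideal_if_valuation_domain_localization) auto
    moreover have "Q \<subset> D" using F(1)[OF Q(1)] by (auto simp: prime_ideal_def ideal_def)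
    ultimately have "Q = M" using M Q(3) unfolding maximal_t_ideal_def by blast
    then show ?thesis using Q(1) by simp
  qed
  obtain x where x: "x \<in> P" "x \<noteq> 0"
    using maximal_t_ideal_nonzero[OF P] submodule_zero[OF maximal_t_ideal_submodule[OF P]] by blast
  \<comment> \<open>These are the competitors of \<open>P\<close> at \<open>x\<close>. They are
    finitely many because they belong to \<open>F\<close>, and by maximality each misses some
    element of \<open>P\<close>; adjoining those elements to \<open>x\<close> singles out
    \<open>P\<close>.\<close>
  define G where "G = {Q. maximal_t_ideal D Q \<and> x \<in> Q \<and> Q \<noteq> P}"
  have "G \<subseteq> {Q \<in> F. x \<in> Q}" using in_F by (auto simp: G_def)
  then have "finite G" using finF[OF x P] finite_subset by blast
  have "\<forall>Q\<in>G. \<exists>y. y \<in> P \<and> y \<notin> Q" using maximal_t_ideal_eqI[OF P] by (auto simp: G_def)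
  then obtain y where y: "\<And>Q. Q \<in> G \<Longrightarrow> y Q \<in> P \<and> y Q \<notin> Q" unfolding bchoice_iff by blast
  show ?thesis
  proof (rule potentI[OF P, of "insert x (y ` G)"])
    show "Q = P" if "maximal_t_ideal D Q" "insert x (y ` G) \<subseteq> Q" for Q
      using that y by (auto simp: G_def)
  qed (use \<open>finite G\<close> x y in auto)
qed

end

theorem theorem3p4:
  fixes D :: "'k::field set"
  assumes "domain_with_quotient_field D"
    and "PVMD D"
  shows "generalized_krull_domain D \<longleftrightarrow>
    completely_integrally_closed D \<and> (\<forall>P. maximal_t_ideal D P \<longrightarrow> potent D P)"
proof -
  interpret quotient_domain D by unfold_locales (rule assms(1))
  show ?thesis
    using generalized_krull_domain_if_potent[OF assms(2)]
      generalized_krull_domain_completely_integrally_closed generalized_krull_domain_potent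
    by blast
qed

end
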